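(* Let $u,v\in S_n$ be two distinct permutations. If $\ell(v)\geq \ell(u)$, then there exists an inversion-minimal transposition on $(u,v)$.
   Context: $\ell(w)$ is the Coxeter length of $w\in S_n$, i.e. its number of inversions. A permutation $w$ is written in one-line notation with $w_i=w(i)$. For $u,v\in S_n$, a transposition $(i\,k)$ with $i<k$ is called inversion-minimal on $(u,v)$ if $v_i>v_k$ and $u_i<u_k$, and the interval $[i,k]$ is minimal with respect to inclusion with this property, i.e. there is no proper subinterval $[p,q]\subsetneq[i,k]$, $p<q$, with $v_p>v_q$ and $u_p<u_q$. *)

theory Defs
  imports "HOL-Combinatorics.Permutations"
begin

text \<open>
  The symmetric group \<open>S\<^sub>n\<close> is rendered as the functions \<open>w\<close> with \<open>w permutes {1..n}\<close>; the
  one-line notation \<open>w\<^sub>i\<close> is \<open>w i\<close>.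
\<close>

definition inversions :: "nat \<Rightarrow> (nat \<Rightarrow> nat) \<Rightarrow> (nat \<times> nat) set" where
  "inversions n w = {(i, j). 1 \<le> i \<and> i < j \<and> j \<le> n \<and> w i > w j}"

definition coxeter_length :: "nat \<Rightarrow> (nat \<Rightarrow> nat) \<Rightarrow> nat" where
  "coxeter_length n w = card (inversions n w)"

text \<open>
  A transposition \<open>(i k)\<close> is represented by the pair of its positions \<open>i < k\<close>, which it determines.
  A subinterval \<open>{p..q}\<close> with \<open>p < q\<close> contained in \<open>{i..k}\<close> automatically lies in \<open>{1..n}\<close>.
\<close>

definition inversion_minimal ::
    "nat \<Rightarrow> (nat \<Rightarrow> nat) \<Rightarrow> (nat \<Rightarrow> nat) \<Rightarrow> nat \<Rightarrow> nat \<Rightarrow> bool" where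
  "inversion_minimal n u v i k \<longleftrightarrow>
     i \<in> {1..n} \<and> k \<in> {1..n} \<and> i < k \<and> v i > v k \<and> u i < u k \<and>
     \<not> (\<exists>p q. p < q \<and> {p..q} \<subset> {i..k} \<and> v p > v q \<and> u p < u q)"

end

theory Submission
  imports Defs
begin

text \<open>
  A permutation is recovered from its inversion set: the set tells which of any two values is
  the smaller one, and \<open>w i\<close> is one more than the number of values below it
  (\<open>inversions_inj\<close>). Suppose no pair is inverted by \<open>v\<close> but not by \<open>u\<close>. Then the
  inversion set of \<open>v\<close> is contained in that of \<open>u\<close>; since it has at least as many
  elements, the two sets agree and \<open>u = v\<close>. So distinct \<open>u\<close> and \<open>v\<close> with
  \<open>\<ell>(v) \<ge> \<ell>(u)\<close> admit such a pair, and a pair of least distance is minimal with respect to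
  inclusion because a proper subinterval is strictly shorter.
\<close>

lemma finite_inversions: "finite (inversions n w)"
  by (rule finite_subset[of _ "{1..n} \<times> {1..n}"]) (auto simp: inversions_def)

text \<open>Since \<open>w\<close> permutes \<open>{1..n}\<close>, each value in \<open>{1..<w i}\<close> is attained exactly once.\<close>

lemma permutes_eq_Suc_card_smaller:
  assumes w: "w permutes {1..n}" and i: "i \<in> {1..n}"
  shows "w i = Suc (card {j \<in> {1..n}. w j < w i})"
proof -
  have wi: "w i \<in> {1..n}"
    using permutes_in_image[OF w] i by blast
  have "w ` {j \<in> {1..n}. w j < w i} = {x \<in> w ` {1..n}. x < w i}"
    by auto
  also have "\<dots> = {1..<w i}"
    using wi unfolding permutes_image[OF w] by auto
  finally have "card (w ` {j \<in> {1..n}. w j < w i}) = w i - 1"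
    by simp
  then have "card {j \<in> {1..n}. w j < w i} = w i - 1"
    by (simp add: card_image permutes_inj_on[OF w])
  with wi show ?thesis
    by simp
qed

lemma permutes_less_iff_inversions:
  assumes w: "w permutes {1..n}" and "i \<in> {1..n}" "j \<in> {1..n}"
  shows "w j < w i \<longleftrightarrow> j < i \<and> (j, i) \<notin> inversions n w \<or> (i, j) \<in> inversions n w"
proof -
  have "w i = w j \<longleftrightarrow> i = j"
    using permutes_inj[OF w] by (simp add: inj_eq)
  then show ?thesis
    using assms(2,3) by (cases i j rule: linorder_cases) (auto simp: inversions_def)
qed

text \<open>
  Only the order of the values at two positions matters for the count of smaller values, and
  that order can be read off the inversion set.
\<close>

lemma inversions_inj:
  assumes u: "u permutes {1..n}" and v: "v permutes {1..n}"
    and eq: "inversions n u = inversions n v"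
  shows "u = v"
proof
  fix i
  show "u i = v i"
  proof (cases "i \<in> {1..n}")
    case True
    have "{j \<in> {1..n}. u j < u i} = {j \<in> {1..n}. v j < v i}"
      using permutes_less_iff_inversions[OF u True] permutes_less_iff_inversions[OF v True] eq
      by blast
    then show ?thesis
      using permutes_eq_Suc_card_smaller[OF u True] permutes_eq_Suc_card_smaller[OF v True]
      by simp
  next
    case False
    then show ?thesis
      using u v by (simp add: permutes_not_in)
  qed
qed

text \<open>A subset that is at least as large as the finite set containing it is the whole set.\<close>

lemma inversions_not_subset:
  assumes "u permutes {1..n}" "v permutes {1..n}" "u \<noteq> v"
    and "coxeter_length n v \<ge> coxeter_length n u"
  shows "\<not> inversions n v \<subseteq> inversions n u"
proof
  assume "inversions n v \<subseteq> inversions n u"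
  then have "inversions n v = inversions n u"
    using assms(4) by (intro card_seteq finite_inversions) (simp_all add: coxeter_length_def)
  then show False
    using inversions_inj assms(1-3) by metis
qed

theorem corollary3p5:
  fixes n :: nat and u v :: "nat \<Rightarrow> nat"
  assumes "u permutes {1..n}" and "v permutes {1..n}" and "u \<noteq> v"
    and "coxeter_length n v \<ge> coxeter_length n u"
  shows "\<exists>i k. inversion_minimal n u v i k"
proof -
  define P where "P = (\<lambda>(i, k). i \<in> {1..n} \<and> k \<in> {1..n} \<and> i < k \<and> v i > v k \<and> u i < u k)"
  obtain a b where ab: "(a, b) \<in> inversions n v" "(a, b) \<notin> inversions n u"
    using inversions_not_subset[OF assms] by auto
  moreover from ab have "u a \<noteq> u b"
    using permutes_inj[OF assms(1)] by (auto simp: inversions_def inj_eq)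
  ultimately have "P (a, b)"
    by (auto simp: P_def inversions_def)
  \<comment> \<open>Least distance suffices: a proper subinterval of \<open>{i..k}\<close> has endpoints closer together.\<close>
  then obtain x where x: "P x" and least: "\<And>y. P y \<Longrightarrow> snd x - fst x \<le> snd y - fst y"
    using ex_has_least_nat[of P "(a, b)" "\<lambda>x. snd x - fst x"] by blast
  obtain i k where [simp]: "x = (i, k)"
    by (cases x)
  have ik: "i \<in> {1..n}" "k \<in> {1..n}" "i < k" "v i > v k" "u i < u k"
    using x by (auto simp: P_def)
  have False if pq: "p < q" "{p..q} \<subset> {i..k}" "v p > v q" "u p < u q" for p q
  proof -
    have bounds: "i \<le> p" "q \<le> k" "p \<noteq> i \<or> q \<noteq> k"
      using pq(1,2) by auto
    with ik pq have "P (p, q)"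
      by (auto simp: P_def)
    then have "k - i \<le> q - p"
      using least by fastforce
    with bounds pq(1) show False
      by linarith
  qed
  with ik have "inversion_minimal n u v i k"
    unfolding inversion_minimal_def by blast
  then show ?thesis
    by blast
qed

end
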